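(* Let $A$ be a closed, densely defined linear (possibly unbounded) operator in a Hilbert space $H$ with null space $N$, and let $T=A^*A$, $T_a=T+aI$ for $a>0$. Let $f=Ay$, where $y$ is in the domain of $A$ and $y\perp N$. Let $a:[0,\infty)\to(0,\infty)$ be a monotonically decaying continuous function such that $\lim_{t\to\infty}a(t)=0$ and $\int_0^\infty a(t)\,dt=\infty$. For $\delta>0$ let $f_\delta\in H$ satisfy $\|f_\delta-f\|\le\delta$, and let $u_\delta(t)$, $t\ge0$, be the solution of $$\dot u_\delta=-u_\delta+T_{a(t)}^{-1}A^*f_\delta,\qquad u_\delta(0)=0 .$$ If $t_\delta$ is chosen so that $$\lim_{\delta\to0}t_\delta=\infty,\qquad \lim_{\delta\to0}\frac{\delta}{\sqrt{a(t_\delta)}}=0,$$ then $$\lim_{\delta\to0}\|u_\delta(t_\delta)-y\|=0 .$$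
   Context: $N=N(A)=\{u: Au=0\}$; $A^*$ is the adjoint of $A$; $T=A^*A\ge0$ is selfadjoint; $I$ is the identity; $\dot u=du/dt$. For constant $a>0$, the operator $T_a^{-1}A^*$ with domain $D(A^* )$ is closable and its closure, again denoted $T_a^{-1}A^*$, is a bounded operator defined on all of $H$ with $\|T_a^{-1}A^*\|\le \frac{1}{2\sqrt a}$ (it is the adjoint of the bounded operator $AT_a^{-1}$). The notation $T_{a(t)}^{-1}A^*f_\delta$ refers to this closure. *)

theory Defs
  imports "HOL-Analysis.Analysis"
begin

text \<open>
  An unbounded operator in a Hilbert space is given by its domain \<open>D\<close> and a total function \<open>A\<close>
  whose values outside \<open>D\<close> are never used. Domains of derived operators are explicit.

  Hilbert spaces are types of sort \<open>{real_inner, complete_space}\<close>. This includes complex Hilbert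
  spaces: restrict the scalars to the reals and take the real part of the inner product.
  Norm, domain and graph stay the same, and by lemma \<open>complex_adjoint_iff\<close> and lemma
  \<open>complex_orthogonal_iff\<close> below so do adjoints and orthogonality to the null space.
\<close>

definition linear_op :: "'a::real_vector set \<Rightarrow> ('a \<Rightarrow> 'a) \<Rightarrow> bool" where
  "linear_op D A \<longleftrightarrow> subspace D \<and>
     (\<forall>u\<in>D. \<forall>v\<in>D. A (u + v) = A u + A v) \<and> (\<forall>c. \<forall>u\<in>D. A (c *\<^sub>R u) = c *\<^sub>R A u)"

definition op_graph :: "'a set \<Rightarrow> ('a \<Rightarrow> 'a) \<Rightarrow> ('a \<times> 'a) set" where
  "op_graph D A = (\<lambda>u. (u, A u)) ` D"

definition closed_op :: "'a::topological_space set \<Rightarrow> ('a \<Rightarrow> 'a) \<Rightarrow> bool" where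
  "closed_op D A \<longleftrightarrow> closed (op_graph D A)"

definition densely_defined :: "'a::topological_space set \<Rightarrow> bool" where
  "densely_defined D \<longleftrightarrow> closure D = UNIV"

definition null_space :: "'a::real_vector set \<Rightarrow> ('a \<Rightarrow> 'a) \<Rightarrow> 'a set" where
  "null_space D A = {u \<in> D. A u = 0}"

definition adjoint_dom :: "'a::real_inner set \<Rightarrow> ('a \<Rightarrow> 'a) \<Rightarrow> 'a set" where
  "adjoint_dom D A = {v. \<exists>w. \<forall>u\<in>D. A u \<bullet> v = u \<bullet> w}"

definition adjoint_op :: "'a::real_inner set \<Rightarrow> ('a \<Rightarrow> 'a) \<Rightarrow> 'a \<Rightarrow> 'a" where
  "adjoint_op D A v = (THE w. \<forall>u\<in>D. A u \<bullet> v = u \<bullet> w)"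

text \<open>The operator \<open>T = A\<^sup>*A\<close> on its natural domain, \<open>T\<^sub>a = T + aI\<close>, and the inverse of \<open>T\<^sub>a\<close>.\<close>

definition T_dom :: "'a::real_inner set \<Rightarrow> ('a \<Rightarrow> 'a) \<Rightarrow> 'a set" where
  "T_dom D A = {u \<in> D. A u \<in> adjoint_dom D A}"

definition T_op :: "'a::real_inner set \<Rightarrow> ('a \<Rightarrow> 'a) \<Rightarrow> 'a \<Rightarrow> 'a" where
  "T_op D A u = adjoint_op D A (A u)"

definition T_shift :: "'a::real_inner set \<Rightarrow> ('a \<Rightarrow> 'a) \<Rightarrow> real \<Rightarrow> 'a \<Rightarrow> 'a" where
  "T_shift D A a u = T_op D A u + a *\<^sub>R u"

definition T_shift_inv :: "'a::real_inner set \<Rightarrow> ('a \<Rightarrow> 'a) \<Rightarrow> real \<Rightarrow> 'a \<Rightarrow> 'a" where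
  "T_shift_inv D A a = the_inv_into (T_dom D A) (T_shift D A a)"

text \<open>The closure of a closable operator is the operator whose graph is the closure of its graph.\<close>

definition closure_op :: "'a::topological_space set \<Rightarrow> ('a \<Rightarrow> 'a) \<Rightarrow> 'a \<Rightarrow> 'a" where
  "closure_op D B g = (THE h. (g, h) \<in> closure (op_graph D B))"

definition T_inv_adjoint :: "'a::real_inner set \<Rightarrow> ('a \<Rightarrow> 'a) \<Rightarrow> real \<Rightarrow> 'a \<Rightarrow> 'a" where
  "T_inv_adjoint D A a =
     closure_op (adjoint_dom D A) (\<lambda>v. T_shift_inv D A a (adjoint_op D A v))"

text \<open>In the next two lemmas \<open>J\<close> is multiplication by the imaginary unit.\<close>

lemma complex_adjoint_iff:
  fixes ip :: "'a::real_inner \<Rightarrow> 'a \<Rightarrow> complex" and J :: "'a \<Rightarrow> 'a"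
  assumes re: "\<And>x y. Re (ip x y) = x \<bullet> y"
    and J: "\<And>x y. ip (J x) y = \<i> * ip x y"
    and A: "\<And>u. u \<in> D \<Longrightarrow> J u \<in> D \<and> A (J u) = J (A u)"
  shows "(\<forall>u\<in>D. ip (A u) v = ip u w) \<longleftrightarrow> (\<forall>u\<in>D. A u \<bullet> v = u \<bullet> w)"
proof
  assume "\<forall>u\<in>D. ip (A u) v = ip u w"
  then show "\<forall>u\<in>D. A u \<bullet> v = u \<bullet> w" by (metis re)
next
  assume R: "\<forall>u\<in>D. A u \<bullet> v = u \<bullet> w"
  have im: "Im (ip x y) = - (J x \<bullet> y)" for x y
    using re[of "J x" y] J[of x y] by simp
  show "\<forall>u\<in>D. ip (A u) v = ip u w"
    using R A by (metis complex_eq_iff im re)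
qed

lemma complex_orthogonal_iff:
  fixes ip :: "'a::real_inner \<Rightarrow> 'a \<Rightarrow> complex" and J :: "'a \<Rightarrow> 'a"
  assumes re: "\<And>x y. Re (ip x y) = x \<bullet> y"
    and J: "\<And>x y. ip (J x) y = \<i> * ip x y"
    and N: "\<And>z. z \<in> N \<Longrightarrow> J z \<in> N"
  shows "(\<forall>z\<in>N. ip z y = 0) \<longleftrightarrow> (\<forall>z\<in>N. orthogonal y z)"
proof -
  have "Im (ip x y) = - (J x \<bullet> y)" for x
    using re[of "J x" y] J[of x y] by simp
  then show ?thesis
    using N re unfolding orthogonal_def complex_eq_iff
    by (metis inner_commute neg_equal_0_iff_equal zero_complex.sel)
qed

end

theory Submission
  imports Defs
begin

text \<open>
  The operator \<open>S\<^sub>a = T\<^sub>a\<^sup>-\<^sup>1A\<^sup>*\<close> is Tikhonov regularization: \<open>S\<^sub>a g\<close> minimizes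
  \<open>\<parallel>A w - g\<parallel>\<^sup>2 + a \<parallel>w\<parallel>\<^sup>2\<close> over \<open>w \<in> D\<close>. Its Euler equation

    \<open>a \<langle>w, u\<rangle> + \<langle>A w, A u\<rangle> = \<langle>g, A u\<rangle>\<close> for all \<open>u \<in> D\<close>

  involves neither \<open>A\<^sup>*\<close> nor an inverse nor a closure, makes sense for every \<open>g\<close>, and is solvable
  because it describes the orthogonal projection of \<open>(0, g)\<close> onto the closed subspace
  \<open>{(\<surd>a u, A u) | u \<in> D}\<close> of \<open>H \<times> H\<close> (\<open>weak_solution_exists\<close>). All estimates come from testing it
  with \<open>u = w\<close>, so no spectral theorem is used. Lemma \<open>T_inv_adjoint_eq\<close> identifies its solution
  with the value at \<open>g\<close> of the closure of \<open>T\<^sub>a\<^sup>-\<^sup>1A\<^sup>*\<close>; this rests on the bound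
  \<open>\<parallel>S\<^sub>a g\<parallel> \<le> \<parallel>g\<parallel> / (2\<surd>a)\<close> and on the density of the domain of \<open>A\<^sup>*\<close>.

  Two facts about \<open>S\<^sub>a\<close> drive the convergence. Noise of size \<open>\<delta>\<close> in the data changes \<open>S\<^sub>a f\<close> by at
  most \<open>\<delta> / (2\<surd>a)\<close>. With exact data, the error \<open>e = y - S\<^sub>a A y\<close> satisfies
  \<open>\<parallel>e\<parallel> \<le> \<parallel>y - A\<^sup>*q\<parallel> + \<surd>a \<parallel>q\<parallel> / 2\<close> for every \<open>q\<close> in the domain of \<open>A\<^sup>*\<close>; since \<open>y \<bottom> N\<close> lies in the
  closure of the range of \<open>A\<^sup>*\<close>, the error tends to \<open>0\<close> as \<open>a\<close> does
  (\<open>regularization_error_tendsto\<close>).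

  Finally, \<open>v = u\<^sub>\<delta> - y\<close> solves \<open>v' = -v + h\<close> with \<open>h(t) = S\<^bsub>a(t)\<^esub> f\<^sub>\<delta> - y\<close>, and this equation forgets
  its past exponentially fast. Up to a large time \<open>t\<close> the noise part of \<open>h\<close> is at most
  \<open>\<delta> / (2\<surd>a(t))\<close>, since \<open>a\<close> decreases, and from some time \<open>s\<close> on, the rest of \<open>h\<close> is small, so
  \<open>\<parallel>v(t)\<parallel> \<le> e\<^bsup>s-t\<^esup> \<parallel>y\<parallel> + \<delta> / (2\<surd>a(t)) + \<epsilon>\<close>. The choice of \<open>t\<^sub>\<delta>\<close> makes the right side small.
\<close>

section \<open>Orthogonal projection in a Hilbert space\<close>

text \<open>
  A minimizing sequence for the distance is Cauchy by the parallelogram law, because midpoints of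
  its terms stay in the subspace; its limit is the nearest point, and the residual of a nearest
  point is orthogonal to the subspace.
\<close>

lemma projection_onto_closed_subspace:
  fixes S :: "'b::{real_inner, complete_space} set"
  assumes cl: "closed S" and sub: "subspace S"
  obtains p where "p \<in> S" "\<And>s. s \<in> S \<Longrightarrow> (x - p) \<bullet> s = 0"
proof -
  define d where "d = infdist x S"
  have S0: "S \<noteq> {}" using subspace_0[OF sub] by auto
  have d0: "d \<ge> 0" unfolding d_def by (rule infdist_nonneg)
  have lower: "d \<le> norm (x - s)" if "s \<in> S" for s
    using infdist_le[OF that, of x] by (simp add: d_def dist_norm)
  have "\<exists>s\<in>S. (norm (x - s))\<^sup>2 < d\<^sup>2 + 1 / real (Suc n)" for n
  proof -
    have "d < sqrt (d\<^sup>2 + 1 / real (Suc n))" using d0 by (intro real_less_rsqrt) simp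
    then have "(INF s\<in>S. dist x s) < sqrt (d\<^sup>2 + 1 / real (Suc n))"
      by (simp add: d_def infdist_notempty[OF S0])
    then obtain s where s: "s \<in> S" "norm (x - s) < sqrt (d\<^sup>2 + 1 / real (Suc n))"
      using cINF_less_iff[OF S0 bdd_below_image_dist] by (auto simp: dist_norm)
    have "(norm (x - s))\<^sup>2 < (sqrt (d\<^sup>2 + 1 / real (Suc n)))\<^sup>2"
      using s(2) by (intro power_strict_mono) auto
    then show ?thesis using s(1) by auto
  qed
  then obtain s where sS: "\<And>n. s n \<in> S"
    and s_near: "\<And>n. (norm (x - s n))\<^sup>2 < d\<^sup>2 + 1 / real (Suc n)"
    by metis
  have gap: "(dist (s m) (s n))\<^sup>2 \<le> 2 / real (Suc m) + 2 / real (Suc n)" for m n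
  proof -
    let ?c = "(1/2) *\<^sub>R (s m + s n)"
    have "?c \<in> S" using sS sub by (simp add: subspace_add subspace_scale)
    then have "d\<^sup>2 \<le> (norm (x - ?c))\<^sup>2" using lower d0 by (intro power_mono) auto
    \<comment> \<open>the parallelogram law for \<open>x - s m\<close> and \<open>x - s n\<close>\<close>
    moreover have "(dist (s m) (s n))\<^sup>2
        = 2 * (norm (x - s m))\<^sup>2 + 2 * (norm (x - s n))\<^sup>2 - 4 * (norm (x - ?c))\<^sup>2"
      unfolding dist_norm power2_norm_eq_inner by (simp add: algebra_simps inner_commute)
    ultimately show ?thesis using s_near[of m] s_near[of n] by simp
  qed
  have "Cauchy s"
  proof (rule metric_CauchyI)
    fix e :: real assume e: "e > 0"
    then obtain M where M: "1 / real (Suc M) < e\<^sup>2 / 4"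
      using nat_approx_posE[of "e\<^sup>2 / 4"] by auto
    show "\<exists>M. \<forall>m\<ge>M. \<forall>n\<ge>M. dist (s m) (s n) < e"
    proof (intro exI allI impI)
      fix m n assume mn: "m \<ge> M" "n \<ge> M"
      have "1 / real (Suc m) \<le> 1 / real (Suc M)" "1 / real (Suc n) \<le> 1 / real (Suc M)"
        using mn by (auto simp: frac_le)
      then have "(dist (s m) (s n))\<^sup>2 < e\<^sup>2" using gap[of m n] M by simp
      then show "dist (s m) (s n) < e" using e by (simp add: power_less_imp_less_base)
    qed
  qed
  then obtain p where lim: "s \<longlonglongrightarrow> p" using Cauchy_convergent_iff convergent_def by blast
  have pS: "p \<in> S" using closed_sequentially[OF cl _ lim] sS by auto
  have lim_s: "(\<lambda>n. (norm (x - s n))\<^sup>2) \<longlonglongrightarrow> (norm (x - p))\<^sup>2"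
    by (intro tendsto_intros lim)
  have lim_d: "(\<lambda>n. d\<^sup>2 + 1 / real (Suc n)) \<longlonglongrightarrow> d\<^sup>2 + 0"
    by (intro tendsto_add tendsto_const LIMSEQ_Suc[OF lim_1_over_n])
  have "(norm (x - p))\<^sup>2 \<le> d\<^sup>2 + 0"
    using less_imp_le[OF s_near] by (intro LIMSEQ_le[OF lim_s lim_d] exI allI impI)
  then have "norm (x - p) \<le> d" using power2_le_imp_le[OF _ d0] by simp
  then have best: "norm (x - p) \<le> norm (x - t)" if "t \<in> S" for t
    using lower[OF that] by simp
  have "(x - p) \<bullet> t = 0" if t: "t \<in> S" for t
  proof (cases "t = 0")
    case False
    \<comment> \<open>\<open>c\<close> minimizes the quadratic polynomial \<open>\<lambda>c. (norm (x - (p + c *\<^sub>R t)))\<^sup>2\<close>\<close>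
    define c where "c = ((x - p) \<bullet> t) / (t \<bullet> t)"
    have tt: "t \<bullet> t > 0" using False by simp
    have "p + c *\<^sub>R t \<in> S" using pS t sub by (simp add: subspace_add subspace_scale)
    from best[OF this] have "(norm (x - p))\<^sup>2 \<le> (norm (x - (p + c *\<^sub>R t)))\<^sup>2"
      by (intro power_mono) auto
    also have "\<dots> = (norm (x - p))\<^sup>2 - 2 * c * ((x - p) \<bullet> t) + c * c * (t \<bullet> t)"
      unfolding power2_norm_eq_inner by (simp add: algebra_simps inner_commute)
    also have "\<dots> = (norm (x - p))\<^sup>2 - ((x - p) \<bullet> t)\<^sup>2 / (t \<bullet> t)"
      unfolding c_def using tt by (simp add: field_simps power2_eq_square)
    finally have "((x - p) \<bullet> t)\<^sup>2 / (t \<bullet> t) \<le> 0" by simp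
    then show ?thesis using tt by (simp add: divide_le_0_iff)
  qed simp
  then show thesis using that pS by blast
qed

lemma subspace_closure_normed:
  fixes S :: "'b::real_normed_vector set"
  assumes sub: "subspace S"
  shows "subspace (closure S)"
proof (intro subspaceI)
  show "0 \<in> closure S" using subspace_0[OF sub] closure_subset by blast
next
  fix x y assume "x \<in> closure S" "y \<in> closure S"
  then obtain X Y where "\<And>n. X n \<in> S" "X \<longlonglongrightarrow> x" "\<And>n. Y n \<in> S" "Y \<longlonglongrightarrow> y"
    by (auto simp: closure_sequential)
  then show "x + y \<in> closure S"
    unfolding closure_sequential using subspace_add[OF sub]
    by (intro exI[of _ "\<lambda>n. X n + Y n"]) (auto intro: tendsto_intros)
next
  fix c :: real and x assume "x \<in> closure S"
  then obtain X where "\<And>n. X n \<in> S" "X \<longlonglongrightarrow> x" by (auto simp: closure_sequential)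
  then show "c *\<^sub>R x \<in> closure S"
    unfolding closure_sequential using subspace_scale[OF sub]
    by (intro exI[of _ "\<lambda>n. c *\<^sub>R X n"]) (auto intro: tendsto_intros)
qed

text \<open>
  Density statements reduce to computing an orthogonal complement: the residual of the projection
  of \<open>x\<close> onto \<open>closure S\<close> is one of the vectors \<open>z\<close> in the hypothesis.
\<close>

lemma mem_closure_if_orthogonal_to_complement:
  fixes S :: "'b::{real_inner, complete_space} set"
  assumes sub: "subspace S"
    and orth: "\<And>z. (\<And>s. s \<in> S \<Longrightarrow> z \<bullet> s = 0) \<Longrightarrow> x \<bullet> z = 0"
  shows "x \<in> closure S"
proof -
  have "subspace (closure S)" using sub by (rule subspace_closure_normed)
  then obtain p where p: "p \<in> closure S" "\<And>s. s \<in> closure S \<Longrightarrow> (x - p) \<bullet> s = 0"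
    using projection_onto_closed_subspace[OF closed_closure] by metis
  have "x \<bullet> (x - p) = 0" using p(2) closure_subset by (intro orth) blast
  moreover have "(x - p) \<bullet> p = 0" using p by blast
  ultimately have "(x - p) \<bullet> (x - p) = 0" by (simp add: inner_diff_right inner_commute)
  then show ?thesis using p(1) by simp
qed

section \<open>The regularized normal equation in weak form\<close>

text \<open>
  The weak form of \<open>(T + aI) w = p + A\<^sup>*g\<close>. The second slot of the right-hand side is paired with
  \<open>A u\<close> instead of applying \<open>A\<^sup>*\<close> to \<open>g\<close>, so the equation makes sense for every vector \<open>g\<close>.
\<close>

definition weak_solution ::
  "'a::real_inner set \<Rightarrow> ('a \<Rightarrow> 'a) \<Rightarrow> real \<Rightarrow> 'a \<Rightarrow> 'a \<Rightarrow> 'a \<Rightarrow> bool" where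
  "weak_solution D A a p g w \<longleftrightarrow>
     w \<in> D \<and> (\<forall>u\<in>D. a * (w \<bullet> u) + A w \<bullet> A u = p \<bullet> u + g \<bullet> A u)"

lemma weak_solutionD:
  assumes "weak_solution D A a p g w"
  shows "w \<in> D" and "u \<in> D \<Longrightarrow> a * (w \<bullet> u) + A w \<bullet> A u = p \<bullet> u + g \<bullet> A u"
  using assms by (auto simp: weak_solution_def)

locale closed_dense_operator =
  fixes D :: "'a::{real_inner, complete_space} set" and A :: "'a \<Rightarrow> 'a"
  assumes linear: "linear_op D A" and closed: "closed_op D A" and dense: "densely_defined D"
begin

lemma subspace_D: "subspace D" using linear by (simp add: linear_op_def)
lemma A_add: "u \<in> D \<Longrightarrow> v \<in> D \<Longrightarrow> A (u + v) = A u + A v"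
  using linear by (simp add: linear_op_def)
lemma A_scale: "u \<in> D \<Longrightarrow> A (c *\<^sub>R u) = c *\<^sub>R A u"
  using linear by (simp add: linear_op_def)
lemma D_diff: "u \<in> D \<Longrightarrow> v \<in> D \<Longrightarrow> u - v \<in> D" by (rule subspace_diff[OF subspace_D])
lemma A_diff: "u \<in> D \<Longrightarrow> v \<in> D \<Longrightarrow> A (u - v) = A u - A v"
  using A_add[of u "(-1) *\<^sub>R v"] A_scale[of v "-1"] subspace_scale[OF subspace_D, of v "-1"] by simp

lemma eq_zero_if_orthogonal_to_domain:
  assumes "\<And>u. u \<in> D \<Longrightarrow> u \<bullet> z = 0"
  shows "z = 0"
proof -
  have "D \<subseteq> {u. u \<bullet> z = 0}" using assms by auto
  moreover have "closed {u. u \<bullet> z = 0}"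
    by (intro closed_Collect_eq continuous_intros)
  ultimately have "closure D \<subseteq> {u. u \<bullet> z = 0}" by (rule closure_minimal)
  then have "z \<in> {u. u \<bullet> z = 0}" using dense unfolding densely_defined_def by blast
  then show ?thesis by simp
qed

lemma adjointI:
  assumes "\<And>u. u \<in> D \<Longrightarrow> A u \<bullet> v = u \<bullet> w"
  shows "v \<in> adjoint_dom D A" and "adjoint_op D A v = w"
proof -
  show "v \<in> adjoint_dom D A" using assms by (auto simp: adjoint_dom_def)
  show "adjoint_op D A v = w" unfolding adjoint_op_def
  proof (rule the_equality)
    show "\<forall>u\<in>D. A u \<bullet> v = u \<bullet> w" using assms by blast
  next
    fix w' assume "\<forall>u\<in>D. A u \<bullet> v = u \<bullet> w'"
    then have "w' - w = 0"
      using assms by (intro eq_zero_if_orthogonal_to_domain) (simp add: inner_diff_right)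
    then show "w' = w" by simp
  qed
qed

lemma adjoint_inner:
  assumes "v \<in> adjoint_dom D A" "u \<in> D"
  shows "A u \<bullet> v = u \<bullet> adjoint_op D A v"
proof -
  obtain w where w: "\<And>u. u \<in> D \<Longrightarrow> A u \<bullet> v = u \<bullet> w"
    using assms(1) by (auto simp: adjoint_dom_def)
  show ?thesis using adjointI(2)[OF w] w assms(2) by auto
qed

text \<open>
  With \<open>r = \<surd>a\<close>, the equation says that \<open>(p / r, g) - (r w, A w)\<close> is orthogonal to all
  \<open>(r u, A u)\<close> with \<open>u \<in> D\<close>. These pairs form a closed subspace, since the graph of \<open>A\<close> is closed and
  rescaling the first coordinate is a homeomorphism.
\<close>

lemma weak_solution_exists:
  assumes a: "a > 0"
  obtains w where "weak_solution D A a p g w"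
proof -
  define r where "r = sqrt a"
  have r: "r > 0" "r * r = a" using a by (auto simp: r_def)
  define G where "G = (\<lambda>u. (r *\<^sub>R u, A u)) ` D"
  have "G = (\<lambda>q. ((1 / r) *\<^sub>R fst q, snd q)) -` op_graph D A"
  proof -
    have "z \<in> (\<lambda>u. (r *\<^sub>R u, A u)) ` D"
      if "(1 / r) *\<^sub>R fst z \<in> D" "snd z = A ((1 / r) *\<^sub>R fst z)" for z :: "'a \<times> 'a"
      using that r by (intro image_eqI[of _ _ "(1 / r) *\<^sub>R fst z"]) (auto simp: prod_eq_iff)
    then show ?thesis using r by (auto simp: G_def op_graph_def)
  qed
  moreover have "closed ((\<lambda>q. ((1 / r) *\<^sub>R fst q, snd q)) -` op_graph D A)"
    using closed unfolding closed_op_def by (intro closed_vimage) (auto intro!: continuous_intros)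
  ultimately have clG: "closed G" by simp
  have subG: "subspace G"
    unfolding G_def
  proof (intro subspaceI)
    show "0 \<in> (\<lambda>u. (r *\<^sub>R u, A u)) ` D"
      using subspace_0[OF subspace_D] A_scale[of 0 0] by (intro image_eqI[of _ _ 0]) (auto simp: zero_prod_def)
  next
    fix x y assume "x \<in> (\<lambda>u. (r *\<^sub>R u, A u)) ` D" "y \<in> (\<lambda>u. (r *\<^sub>R u, A u)) ` D"
    then obtain u v where "u \<in> D" "v \<in> D" "x = (r *\<^sub>R u, A u)" "y = (r *\<^sub>R v, A v)" by auto
    then show "x + y \<in> (\<lambda>u. (r *\<^sub>R u, A u)) ` D"
      using A_add[of u v] subspace_add[OF subspace_D, of u v]
      by (intro image_eqI[of _ _ "u + v"]) (auto simp: algebra_simps)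
  next
    fix c :: real and x assume "x \<in> (\<lambda>u. (r *\<^sub>R u, A u)) ` D"
    then obtain u where "u \<in> D" "x = (r *\<^sub>R u, A u)" by auto
    then show "c *\<^sub>R x \<in> (\<lambda>u. (r *\<^sub>R u, A u)) ` D"
      using A_scale[of u c] subspace_scale[OF subspace_D, of u c]
      by (intro image_eqI[of _ _ "c *\<^sub>R u"]) (auto simp: algebra_simps)
  qed
  obtain q where q: "q \<in> G" "\<And>s. s \<in> G \<Longrightarrow> (((1 / r) *\<^sub>R p, g) - q) \<bullet> s = 0"
    using projection_onto_closed_subspace[OF clG subG] by metis
  from q(1) obtain w where w: "w \<in> D" "q = (r *\<^sub>R w, A w)" by (auto simp: G_def)
  have "a * (w \<bullet> u) + A w \<bullet> A u = p \<bullet> u + g \<bullet> A u" if u: "u \<in> D" for u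
  proof -
    have "(r *\<^sub>R u, A u) \<in> G" using u by (auto simp: G_def)
    from q(2)[OF this] have "((1 / r) *\<^sub>R p - r *\<^sub>R w) \<bullet> (r *\<^sub>R u) + (g - A w) \<bullet> A u = 0"
      unfolding w(2) by (simp add: inner_prod_def)
    moreover have "((1 / r) *\<^sub>R p - r *\<^sub>R w) \<bullet> (r *\<^sub>R u) = p \<bullet> u - a * (w \<bullet> u)"
      using r by (simp add: inner_diff_left right_diff_distrib flip: r(2))
    ultimately show ?thesis by (simp add: inner_diff_left)
  qed
  then show thesis using that w(1) by (auto simp: weak_solution_def)
qed

lemma weak_solution_diff:
  assumes "weak_solution D A a p g w" "weak_solution D A a p' g' w'"
  shows "weak_solution D A a (p - p') (g - g') (w - w')"
  using assms D_diff
  by (simp add: weak_solution_def A_diff inner_diff_left right_diff_distrib) (smt (verit, best))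

lemma weak_solution_energy:
  assumes "weak_solution D A a p g w"
  shows "a * (norm w)\<^sup>2 + (norm (A w))\<^sup>2 = p \<bullet> w + g \<bullet> A w"
  using assms by (auto simp: weak_solution_def power2_norm_eq_inner)

text \<open>
  The factor 2 comes from absorbing the mixed term of the energy identity:
  \<open>\<parallel>g\<parallel> \<parallel>A w\<parallel> - \<parallel>A w\<parallel>\<^sup>2 \<le> \<parallel>g\<parallel>\<^sup>2 / 4\<close>.
\<close>

lemma weak_solution_norm_bound:
  assumes a: "a > 0" and w: "weak_solution D A a 0 g w"
  shows "norm w \<le> norm g / (2 * sqrt a)"
proof -
  have "a * (norm w)\<^sup>2 \<le> norm g * norm (A w) - (norm (A w))\<^sup>2"
    using weak_solution_energy[OF w] norm_cauchy_schwarz[of g "A w"] by simp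
  also have "\<dots> \<le> (norm g / 2)\<^sup>2"
    using zero_le_power2[of "norm (A w) - norm g / 2"] by (simp add: power2_eq_square algebra_simps)
  finally have "(sqrt a * norm w)\<^sup>2 \<le> (norm g / 2)\<^sup>2"
    using a by (simp add: power_mult_distrib)
  then have "sqrt a * norm w \<le> norm g / 2" by (rule power2_le_imp_le) simp
  then show ?thesis using a by (simp add: field_simps)
qed

lemma weak_solution_unique:
  assumes "a > 0" "weak_solution D A a p g w" "weak_solution D A a p g w'"
  shows "w = w'"
  using weak_solution_norm_bound[of a 0 "w - w'"] weak_solution_diff[OF assms(2,3)] assms(1) by simp

text \<open>
  The equation itself says how \<open>g - A w\<close> pairs with the range of \<open>A\<close>, which puts it in the domain of
  the adjoint. This is the source of elements of that domain in both density results below.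
\<close>

lemma weak_solution_residual_adjoint:
  assumes "weak_solution D A a p g w"
  shows "g - A w \<in> adjoint_dom D A" and "adjoint_op D A (g - A w) = a *\<^sub>R w - p"
proof -
  have "A u \<bullet> (g - A w) = u \<bullet> (a *\<^sub>R w - p)" if "u \<in> D" for u
    using weak_solutionD(2)[OF assms that] by (simp add: inner_diff_right inner_commute)
  then show "g - A w \<in> adjoint_dom D A" "adjoint_op D A (g - A w) = a *\<^sub>R w - p"
    using adjointI by blast+
qed

section \<open>Density of the domain and of the range of the adjoint\<close>

lemma subspace_adjoint_dom: "subspace (adjoint_dom D A)"
  and adjoint_add: "v \<in> adjoint_dom D A \<Longrightarrow> w \<in> adjoint_dom D A \<Longrightarrow>
        adjoint_op D A (v + w) = adjoint_op D A v + adjoint_op D A w"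
  and adjoint_scale: "v \<in> adjoint_dom D A \<Longrightarrow> adjoint_op D A (c *\<^sub>R v) = c *\<^sub>R adjoint_op D A v"
proof -
  have add: "A u \<bullet> (v + w) = u \<bullet> (adjoint_op D A v + adjoint_op D A w)"
    if "v \<in> adjoint_dom D A" "w \<in> adjoint_dom D A" "u \<in> D" for u v w
    using that by (simp add: inner_add_right adjoint_inner)
  have scale: "A u \<bullet> (c *\<^sub>R v) = u \<bullet> (c *\<^sub>R adjoint_op D A v)"
    if "v \<in> adjoint_dom D A" "u \<in> D" for u v c
    using that by (simp add: adjoint_inner)
  have "A u \<bullet> 0 = u \<bullet> 0" for u by simp
  then show "subspace (adjoint_dom D A)"
    using adjointI(1)[OF add] adjointI(1)[OF scale] adjointI(1)[of 0 0] by (intro subspaceI) blast+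
  show "v \<in> adjoint_dom D A \<Longrightarrow> w \<in> adjoint_dom D A \<Longrightarrow>
        adjoint_op D A (v + w) = adjoint_op D A v + adjoint_op D A w"
    using adjointI(2)[OF add] by blast
  show "v \<in> adjoint_dom D A \<Longrightarrow> adjoint_op D A (c *\<^sub>R v) = c *\<^sub>R adjoint_op D A v"
    using adjointI(2)[OF scale] by blast
qed

text \<open>
  If \<open>g\<close> is orthogonal to the domain of the adjoint, it is orthogonal to the residual \<open>g - A w\<close> of
  its own regularized problem; combined with the energy identity this forces \<open>w = 0\<close>, then \<open>g = 0\<close>.
\<close>

lemma adjoint_densely_defined: "closure (adjoint_dom D A) = UNIV"
proof -
  have "g = 0" if orth: "\<And>s. s \<in> adjoint_dom D A \<Longrightarrow> g \<bullet> s = 0" for g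
  proof -
    obtain w where w: "weak_solution D A 1 0 g w" using weak_solution_exists[of 1] by auto
    have "g \<bullet> (g - A w) = 0" using orth weak_solution_residual_adjoint(1)[OF w] .
    then have gg: "g \<bullet> g = g \<bullet> A w" by (simp add: inner_diff_right)
    have "0 \<le> (g - A w) \<bullet> (g - A w)" by simp
    also have "\<dots> = - (norm w)\<^sup>2"
      using gg weak_solution_energy[OF w]
      by (simp add: inner_diff_left inner_diff_right inner_commute power2_norm_eq_inner)
    finally have "w = 0" by simp
    then have "A w = 0" using A_scale[of 0 0] subspace_0[OF subspace_D] by simp
    then show "g = 0" using gg by simp
  qed
  then show ?thesis
    using mem_closure_if_orthogonal_to_complement[OF subspace_adjoint_dom] by fastforce
qed

text \<open>
  A vector \<open>z\<close> orthogonal to the range of \<open>A\<^sup>*\<close> lies in the null space of \<open>A\<close>: the weak solution of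
  \<open>(T + I) w = z\<close> satisfies \<open>w - z = A\<^sup>*(-A w)\<close>, which is orthogonal to \<open>z\<close>, and the energy identity
  turns this into \<open>\<parallel>z - w\<parallel>\<^sup>2 = -\<parallel>A w\<parallel>\<^sup>2\<close>.
\<close>

lemma mem_closure_adjoint_range:
  assumes y: "\<And>z. z \<in> null_space D A \<Longrightarrow> y \<bullet> z = 0"
  shows "y \<in> closure (adjoint_op D A ` adjoint_dom D A)"
proof (rule mem_closure_if_orthogonal_to_complement)
  show "subspace (adjoint_op D A ` adjoint_dom D A)"
  proof (intro subspaceI)
    show "0 \<in> adjoint_op D A ` adjoint_dom D A"
      using adjointI[of 0 0] by force
  next
    fix x z assume "x \<in> adjoint_op D A ` adjoint_dom D A" "z \<in> adjoint_op D A ` adjoint_dom D A"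
    then show "x + z \<in> adjoint_op D A ` adjoint_dom D A"
      using subspace_add[OF subspace_adjoint_dom] adjoint_add by (auto simp flip: adjoint_add)
  next
    fix c :: real and x assume "x \<in> adjoint_op D A ` adjoint_dom D A"
    then show "c *\<^sub>R x \<in> adjoint_op D A ` adjoint_dom D A"
      using subspace_scale[OF subspace_adjoint_dom] by (auto simp flip: adjoint_scale)
  qed
next
  fix z assume orth: "\<And>s. s \<in> adjoint_op D A ` adjoint_dom D A \<Longrightarrow> z \<bullet> s = 0"
  obtain w where w: "weak_solution D A 1 z 0 w" using weak_solution_exists[of 1] by auto
  have "z \<bullet> (w - z) = 0"
    using weak_solution_residual_adjoint[OF w] orth by (metis image_eqI scaleR_one)
  then have "(norm (z - w))\<^sup>2 = - (norm (A w))\<^sup>2"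
    using weak_solution_energy[OF w]
    by (simp add: power2_norm_eq_inner inner_diff_left inner_diff_right inner_commute)
  then have "norm (z - w) = 0 \<and> norm (A w) = 0"
    by (smt (verit) power2_eq_iff zero_le_power2 zero_eq_power2)
  then have "z \<in> null_space D A" using weak_solutionD(1)[OF w] by (simp add: null_space_def)
  then show "y \<bullet> z = 0" by (rule y)
qed

section \<open>The regularized inverse\<close>

text \<open>
  For data in the domain of \<open>A\<^sup>*\<close> weak solutions are strong: the equation itself shows that \<open>A w\<close> is in
  the domain of \<open>A\<^sup>*\<close>.
\<close>

lemma T_shift_inv_adjoint_eq:
  assumes a: "a > 0" and v: "v \<in> adjoint_dom D A" and w: "weak_solution D A a 0 v w"
  shows "T_shift_inv D A a (adjoint_op D A v) = w"
proof -
  have Tsol: "weak_solution D A a (T_shift D A a z) 0 z" if z: "z \<in> T_dom D A" for z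
    using z adjoint_inner[of "A z"]
    by (auto simp: weak_solution_def T_dom_def T_shift_def T_op_def inner_add_right inner_commute)
  have "A u \<bullet> A w = u \<bullet> (adjoint_op D A v - a *\<^sub>R w)" if u: "u \<in> D" for u
    using weak_solutionD(2)[OF w u] adjoint_inner[OF v u]
    by (simp add: inner_diff_right inner_commute)
  note Aw = adjointI[OF this]
  have wT: "w \<in> T_dom D A" "T_shift D A a w = adjoint_op D A v"
    using weak_solutionD(1)[OF w] Aw by (auto simp: T_dom_def T_shift_def T_op_def)
  have "inj_on (T_shift D A a) (T_dom D A)"
    using Tsol weak_solution_unique[OF a] by (metis inj_onI)
  from the_inv_into_f_f[OF this wT(1)] show ?thesis by (simp add: T_shift_inv_def wT(2))
qed

text \<open>
  Both inclusions between the closed graph and the graph of \<open>g \<mapsto> w\<close> come from the Lipschitz bound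
  \<open>near\<close>: it makes the latter graph closed, and together with the density of the domain of \<open>A\<^sup>*\<close> it
  shows that each of its points is a limit of points over that domain.
\<close>

lemma T_inv_adjoint_eq:
  assumes a: "a > 0" and w: "weak_solution D A a 0 g w"
  shows "T_inv_adjoint D A a g = w"
proof -
  define B where "B v = T_shift_inv D A a (adjoint_op D A v)" for v
  define G where "G = op_graph (adjoint_dom D A) B"
  have near: "dist w h \<le> dist g v / (2 * sqrt a)" if "weak_solution D A a 0 v h" for v h
    using weak_solution_norm_bound[OF a] weak_solution_diff[OF w that] by (simp add: dist_norm)
  have B: "weak_solution D A a 0 v (B v)" if v: "v \<in> adjoint_dom D A" for v
  proof -
    obtain h where h: "weak_solution D A a 0 v h" using weak_solution_exists[OF a] .
    then show ?thesis using T_shift_inv_adjoint_eq[OF a v h] by (simp add: B_def)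
  qed
  have mem: "(g, h) \<in> closure G \<longleftrightarrow> h = w" for h
  proof
    assume "(g, h) \<in> closure G"
    then obtain s where s: "\<And>n. s n \<in> G" "s \<longlonglongrightarrow> (g, h)" by (auto simp: closure_sequential)
    have lim: "(\<lambda>n. fst (s n)) \<longlonglongrightarrow> g" "(\<lambda>n. snd (s n)) \<longlonglongrightarrow> h"
      using tendsto_fst[OF s(2)] tendsto_snd[OF s(2)] by auto
    have "dist w (snd (s n)) \<le> dist g (fst (s n)) / (2 * sqrt a)" for n
      using s(1)[of n] near B by (auto simp: G_def op_graph_def)
    moreover have "(\<lambda>n. dist w (snd (s n))) \<longlonglongrightarrow> dist w h" by (intro tendsto_intros lim)
    moreover have "(\<lambda>n. dist g (fst (s n)) / (2 * sqrt a)) \<longlonglongrightarrow> dist g g / (2 * sqrt a)"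
      using a by (intro tendsto_intros lim) auto
    ultimately have "dist w h \<le> dist g g / (2 * sqrt a)" by (blast intro: LIMSEQ_le)
    then show "h = w" by simp
  next
    assume h: "h = w"
    have "g \<in> closure (adjoint_dom D A)" by (simp add: adjoint_densely_defined)
    then obtain v where v: "\<And>n. v n \<in> adjoint_dom D A" "v \<longlonglongrightarrow> g"
      by (auto simp: closure_sequential)
    have "(\<lambda>n. dist g (v n) / (2 * sqrt a)) \<longlonglongrightarrow> dist g g / (2 * sqrt a)"
      using a by (intro tendsto_intros v) auto
    then have lim0: "(\<lambda>n. dist g (v n) / (2 * sqrt a)) \<longlonglongrightarrow> 0" by simp
    have "dist (B (v n)) w \<le> dist g (v n) / (2 * sqrt a)" for n
      using near[OF B[OF v(1)[of n]]] by (simp add: dist_commute)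
    then have "(\<lambda>n. dist (B (v n)) w) \<longlonglongrightarrow> 0"
      by (intro tendsto_sandwich[OF _ _ tendsto_const lim0] always_eventually allI) simp_all
    then have "(\<lambda>n. (v n, B (v n))) \<longlonglongrightarrow> (g, w)"
      unfolding tendsto_dist_iff[of "\<lambda>n. B (v n)", symmetric] by (intro tendsto_Pair v(2))
    moreover have "(v n, B (v n)) \<in> G" for n using v(1) by (auto simp: G_def op_graph_def)
    ultimately show "(g, h) \<in> closure G"
      unfolding h closure_sequential by (intro exI[of _ "\<lambda>n. (v n, B (v n))"] conjI allI)
  qed
  show ?thesis
    unfolding T_inv_adjoint_def closure_op_def using mem by (simp add: G_def B_def[abs_def])
qed

lemma T_inv_adjoint_weak_solution:
  assumes "a > 0"
  shows "weak_solution D A a 0 g (T_inv_adjoint D A a g)"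
proof -
  obtain w where w: "weak_solution D A a 0 g w" using weak_solution_exists[OF assms] .
  then show ?thesis using T_inv_adjoint_eq[OF assms w] by simp
qed

lemma T_inv_adjoint_noise:
  assumes "a > 0"
  shows "norm (T_inv_adjoint D A a g - T_inv_adjoint D A a g') \<le> norm (g - g') / (2 * sqrt a)"
proof -
  have "weak_solution D A a 0 (g - g') (T_inv_adjoint D A a g - T_inv_adjoint D A a g')"
    using weak_solution_diff[OF T_inv_adjoint_weak_solution[OF assms, of g]
        T_inv_adjoint_weak_solution[OF assms, of g']] by simp
  then show ?thesis by (rule weak_solution_norm_bound[OF assms])
qed

text \<open>
  The error \<open>y - S\<^sub>a A y\<close> is \<open>a T\<^sub>a\<^sup>-\<^sup>1 y\<close> in weak form: \<open>y\<close> itself solves the equation with the extra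
  right-hand side \<open>a y\<close>.
\<close>

lemma regularization_error_weak_solution:
  assumes a: "a > 0" and y: "y \<in> D"
  shows "weak_solution D A a (a *\<^sub>R y) 0 (y - T_inv_adjoint D A a (A y))"
proof -
  have "weak_solution D A a (a *\<^sub>R y) (A y) y" using y by (simp add: weak_solution_def)
  from weak_solution_diff[OF this T_inv_adjoint_weak_solution[OF a, of "A y"]]
  show ?thesis by simp
qed

lemma regularization_error_le:
  assumes a: "a > 0" and y: "y \<in> D"
  shows "norm (y - T_inv_adjoint D A a (A y)) \<le> norm y"
proof -
  define e where "e = y - T_inv_adjoint D A a (A y)"
  have "a * (norm e)\<^sup>2 + (norm (A e))\<^sup>2 = a * (y \<bullet> e)"
    using weak_solution_energy[OF regularization_error_weak_solution[OF a y]] by (simp add: e_def)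
  then have "a * (norm e)\<^sup>2 \<le> a * (y \<bullet> e)" by (smt (verit) zero_le_power2)
  also have "\<dots> \<le> a * (norm y * norm e)"
    using a norm_cauchy_schwarz[of y e] by (intro mult_left_mono) auto
  finally have "norm e * norm e \<le> norm y * norm e" using a by (simp add: power2_eq_square)
  then show ?thesis unfolding e_def[symmetric] by (cases "e = 0") auto
qed

text \<open>
  Splitting \<open>y = r + A\<^sup>*q\<close> in the energy identity gives
  \<open>a \<parallel>e\<parallel>\<^sup>2 + \<parallel>A e\<parallel>\<^sup>2 = a (\<langle>r, e\<rangle> + \<langle>q, A e\<rangle>)\<close>; the term \<open>\<parallel>A e\<parallel>\<^sup>2\<close> absorbs the last one, which
  leaves a quadratic inequality for \<open>\<parallel>e\<parallel>\<close>.
\<close>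

lemma regularization_error_bound:
  assumes a: "a > 0" and y: "y \<in> D" and q: "q \<in> adjoint_dom D A"
  shows "norm (y - T_inv_adjoint D A a (A y)) \<le> norm (y - adjoint_op D A q) + sqrt a * norm q / 2"
proof -
  define e where "e = y - T_inv_adjoint D A a (A y)"
  define r where "r = y - adjoint_op D A q"
  define c where "c = sqrt a * norm q / 2"
  have sol: "weak_solution D A a (a *\<^sub>R y) 0 e"
    unfolding e_def by (rule regularization_error_weak_solution[OF a y])
  have "a * (norm e)\<^sup>2 = a * (y \<bullet> e) - (norm (A e))\<^sup>2"
    using weak_solution_energy[OF sol] by simp
  also have "y \<bullet> e = r \<bullet> e + q \<bullet> A e"
    using adjoint_inner[OF q weak_solutionD(1)[OF sol]]
    by (simp add: r_def inner_diff_left inner_commute[of q] inner_commute[of e])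
  also have "a * (r \<bullet> e + q \<bullet> A e) - (norm (A e))\<^sup>2
      \<le> a * (norm r * norm e + norm q * norm (A e)) - (norm (A e))\<^sup>2"
    using a norm_cauchy_schwarz[of r e] norm_cauchy_schwarz[of q "A e"]
    by (intro diff_right_mono mult_left_mono add_mono) auto
  also have "\<dots> \<le> a * (norm r * norm e) + (a * norm q / 2)\<^sup>2"
    using zero_le_power2[of "norm (A e) - a * norm q / 2"]
    by (simp add: power2_eq_square algebra_simps)
  also have "\<dots> = a * (norm r * norm e + c\<^sup>2)"
    using a by (simp add: c_def power2_eq_square algebra_simps)
  finally have le: "(norm e)\<^sup>2 \<le> norm r * norm e + c\<^sup>2" using a by simp
  have c: "c \<ge> 0" using a by (simp add: c_def)
  have "norm e \<le> norm r + c"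
  proof (rule ccontr)
    assume "\<not> norm e \<le> norm r + c"
    then have gt: "norm e > norm r + c" by simp
    then have "c * c \<le> c * norm e" using c norm_ge_zero[of r] by (intro mult_left_mono) linarith+
    moreover have "(norm r + c) * norm e < norm e * norm e"
      using gt c norm_ge_zero[of r] by (intro mult_strict_right_mono) linarith+
    ultimately show False using le by (simp add: power2_eq_square algebra_simps)
  qed
  then show ?thesis by (simp add: e_def r_def c_def)
qed

lemma regularization_error_tendsto:
  assumes y: "y \<in> D" and orth: "\<And>z. z \<in> null_space D A \<Longrightarrow> y \<bullet> z = 0"
  shows "((\<lambda>a. norm (y - T_inv_adjoint D A a (A y))) \<longlongrightarrow> 0) (at_right 0)"
proof (rule tendstoI)
  fix \<epsilon> :: real assume \<epsilon>: "\<epsilon> > 0"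
  obtain q where q: "q \<in> adjoint_dom D A" "norm (y - adjoint_op D A q) < \<epsilon> / 2"
    using mem_closure_adjoint_range[OF orth] \<epsilon>
    by (auto simp: closure_approachable dist_norm norm_minus_commute dest!: spec[of _ "\<epsilon> / 2"])
  have "((\<lambda>a. sqrt a * norm q / 2) \<longlongrightarrow> sqrt 0 * norm q / 2) (at_right 0)"
    by (intro tendsto_intros) simp
  then have "\<forall>\<^sub>F a in at_right 0. sqrt a * norm q / 2 < \<epsilon> / 2"
    using \<epsilon> by (intro order_tendstoD(2)) auto
  moreover have "\<forall>\<^sub>F a :: real in at_right 0. a > 0" by (simp add: eventually_at_right_less)
  ultimately show "\<forall>\<^sub>F a in at_right 0. dist (norm (y - T_inv_adjoint D A a (A y))) 0 < \<epsilon>"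
  proof eventually_elim
    case (elim a)
    then show ?case using regularization_error_bound[OF elim(2) y q(1)] q(2) by simp
  qed
qed

end

section \<open>The relaxation equation\<close>

text \<open>
  The integrating factor \<open>e\<^sup>t\<close> turns the equation into \<open>(e\<^sup>t v)' = e\<^sup>t h\<close>. The mean value inequality
  then compares \<open>e\<^sup>t v\<close> with \<open>C e\<^sup>t\<close>, replacing the integral in the variation of constants formula.
\<close>

lemma relaxation_step_bound:
  fixes v h :: "real \<Rightarrow> 'b::real_normed_vector"
  assumes pq: "p \<le> q"
    and v: "\<And>t. p \<le> t \<Longrightarrow> t \<le> q \<Longrightarrow> (v has_vector_derivative - v t + h t) (at t within {p..q})"
    and h: "\<And>t. p \<le> t \<Longrightarrow> t \<le> q \<Longrightarrow> norm (h t) \<le> C"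
  shows "norm (v q) \<le> exp (p - q) * norm (v p) + C * (1 - exp (p - q))"
proof -
  define z where "z t = exp t *\<^sub>R v t" for t
  have z: "(z has_vector_derivative exp t *\<^sub>R h t) (at t within {p..q})" if "p \<le> t" "t \<le> q" for t
  proof -
    have "(z has_vector_derivative exp t *\<^sub>R (- v t + h t) + exp t *\<^sub>R v t) (at t within {p..q})"
      unfolding z_def[abs_def]
      by (intro has_vector_derivative_scaleR v that) (auto intro!: derivative_eq_intros)
    then show ?thesis by (simp add: algebra_simps)
  qed
  have "norm (z q - z p) \<le> C * exp q - C * exp p"
  proof (cases "p = q")
    case False
    show ?thesis
    proof (rule differentiable_bound_general[where f' = "\<lambda>t. exp t *\<^sub>R h t" and \<phi>' = "\<lambda>t. C * exp t"])
      show "p < q" using pq False by simp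
      show "continuous_on {p..q} z"
        using z by (auto intro!: has_vector_derivative_continuous simp: continuous_on_eq_continuous_within)
      show "continuous_on {p..q} (\<lambda>t. C * exp t)" by (intro continuous_intros)
    next
      fix t assume t: "p < t" "t < q"
      show "(z has_vector_derivative exp t *\<^sub>R h t) (at t)"
        using z[of t] t at_within_interior[of t "{p..q}"] by simp
      show "((\<lambda>t. C * exp t) has_vector_derivative C * exp t) (at t)"
        by (auto intro!: derivative_eq_intros simp: has_real_derivative_iff_has_vector_derivative[symmetric])
      show "norm (exp t *\<^sub>R h t) \<le> C * exp t" using h[of t] t by simp
    qed
  qed simp
  then have "norm (z q) \<le> norm (z p) + C * exp q - C * exp p"
    using norm_triangle_ineq2[of "z q" "z p"] by linarith
  then have "exp q * norm (v q) \<le> exp p * norm (v p) + C * exp q - C * exp p" by (simp add: z_def)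
  then show ?thesis by (simp add: exp_diff field_simps)
qed

theorem theorem6:
  fixes D :: "'a::{real_inner, complete_space} set"
    and A :: "'a \<Rightarrow> 'a"
    and y f :: 'a
    and a :: "real \<Rightarrow> real"
    and f\<^sub>\<delta> :: "real \<Rightarrow> 'a"
    and u\<^sub>\<delta> :: "real \<Rightarrow> real \<Rightarrow> 'a"
    and t\<^sub>\<delta> :: "real \<Rightarrow> real"
  assumes linear: "linear_op D A"
    and closed: "closed_op D A"
    and dense: "densely_defined D"
    and y_dom: "y \<in> D"
    and y_orth: "\<forall>z\<in>null_space D A. orthogonal y z"
    and f_eq: "f = A y"
    and a_pos: "\<forall>t\<ge>0. a t > 0"
    and a_decay: "antimono_on {0..} a"
    and a_cont: "continuous_on {0..} a"
    and a_lim: "(a \<longlongrightarrow> 0) at_top"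
    and a_int: "filterlim (\<lambda>x. integral {0..x} a) at_top at_top"
    and f\<^sub>\<delta>_noise: "\<forall>\<delta>>0. norm (f\<^sub>\<delta> \<delta> - f) \<le> \<delta>"
    and u\<^sub>\<delta>_init: "\<forall>\<delta>>0. u\<^sub>\<delta> \<delta> 0 = 0"
    and u\<^sub>\<delta>_ode: "\<forall>\<delta>>0. \<forall>t\<ge>0.
      (u\<^sub>\<delta> \<delta> has_vector_derivative (- u\<^sub>\<delta> \<delta> t + T_inv_adjoint D A (a t) (f\<^sub>\<delta> \<delta>))) (at t within {0..})"
    and t\<^sub>\<delta>_lim: "filterlim t\<^sub>\<delta> at_top (at_right 0)"
    and t\<^sub>\<delta>_rate: "((\<lambda>\<delta>. \<delta> / sqrt (a (t\<^sub>\<delta> \<delta>))) \<longlongrightarrow> 0) (at_right 0)"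
  shows "((\<lambda>\<delta>. norm (u\<^sub>\<delta> \<delta> (t\<^sub>\<delta> \<delta>) - y)) \<longlongrightarrow> 0) (at_right 0)"
proof (rule tendstoI)
  fix \<epsilon> :: real assume \<epsilon>: "\<epsilon> > 0"
  interpret closed_dense_operator D A using linear closed dense by unfold_locales
  define \<beta> where "\<beta> t = norm (y - T_inv_adjoint D A (a t) (A y))" for t
  have \<beta>_le: "\<beta> t \<le> norm y" if "t \<ge> 0" for t
    using regularization_error_le[OF _ y_dom] a_pos that by (simp add: \<beta>_def)
  have "filterlim a (at_right 0) at_top"
    using a_lim a_pos
    by (auto simp: filterlim_at intro!: eventually_mono[OF eventually_ge_at_top[of 0]])
  then have "(\<beta> \<longlongrightarrow> 0) at_top"
    unfolding \<beta>_def[abs_def] using y_orth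
    by (intro filterlim_compose[OF regularization_error_tendsto[OF y_dom]])
       (auto simp: orthogonal_def)
  then have "\<forall>\<^sub>F t in at_top. \<beta> t < \<epsilon> / 4" using \<epsilon> by (intro order_tendstoD(2)) auto
  then obtain s0 where s0: "\<And>t. t \<ge> s0 \<Longrightarrow> \<beta> t < \<epsilon> / 4" by (auto simp: eventually_at_top_linorder)
  define s where "s = max 0 s0"
  have s: "s \<ge> 0" "\<And>t. t \<ge> s \<Longrightarrow> \<beta> t \<le> \<epsilon> / 4" using s0 by (auto simp: s_def less_imp_le)
  \<comment> \<open>the time \<open>s\<close> does not depend on \<open>\<delta>\<close>, so the limit can be taken in this bound\<close>
  have bound: "norm (u\<^sub>\<delta> \<delta> t - y)
      \<le> exp (s - t) * norm y + \<delta> / sqrt (a t) / 2 + \<epsilon> / 4" if \<delta>: "\<delta> > 0" and t: "t \<ge> s" for \<delta> t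
  proof -
    define v where "v r = u\<^sub>\<delta> \<delta> r - y" for r
    define h where "h r = T_inv_adjoint D A (a r) (f\<^sub>\<delta> \<delta>) - y" for r
    define \<eta> where "\<eta> = \<delta> / sqrt (a t) / 2"
    have at: "a t > 0" using a_pos s t by simp
    have \<eta>: "\<eta> \<ge> 0" using \<delta> at by (simp add: \<eta>_def)
    have v': "(v has_vector_derivative - v r + h r) (at r within S)" if "r \<ge> 0" "S \<subseteq> {0..}" for r S
    proof -
      have "(v has_vector_derivative (- u\<^sub>\<delta> \<delta> r + T_inv_adjoint D A (a r) (f\<^sub>\<delta> \<delta>)) - 0) (at r within {0..})"
        unfolding v_def[abs_def] using u\<^sub>\<delta>_ode \<delta> that(1)
        by (intro has_vector_derivative_diff has_vector_derivative_const) auto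
      then show ?thesis
        using has_vector_derivative_within_subset[OF _ that(2)] by (simp add: v_def h_def)
    qed
    have h_le: "norm (h r) \<le> \<eta> + \<beta> r" if r: "0 \<le> r" "r \<le> t" for r
    proof -
      have ar: "a r > 0" "a t \<le> a r"
        using a_pos r a_decay by (auto simp: monotone_on_def)
      have "norm (T_inv_adjoint D A (a r) (f\<^sub>\<delta> \<delta>) - T_inv_adjoint D A (a r) (A y))
          \<le> norm (f\<^sub>\<delta> \<delta> - A y) / (2 * sqrt (a r))"
        by (rule T_inv_adjoint_noise[OF ar(1)])
      also have "\<dots> \<le> \<eta>"
        unfolding \<eta>_def divide_divide_eq_left mult.commute[of _ 2] using f\<^sub>\<delta>_noise f_eq \<delta> at ar
        by (intro frac_le) auto
      finally show ?thesis
        using norm_triangle_ineq4[of "T_inv_adjoint D A (a r) (f\<^sub>\<delta> \<delta>) - T_inv_adjoint D A (a r) (A y)"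
            "y - T_inv_adjoint D A (a r) (A y)"]
        by (simp add: h_def \<beta>_def)
    qed
    \<comment> \<open>up to time \<open>s\<close> only the crude error bound \<open>norm y\<close> is available\<close>
    have "norm (v s) \<le> exp (0 - s) * norm (v 0) + (\<eta> + norm y) * (1 - exp (0 - s))"
    proof (rule relaxation_step_bound)
      fix r assume "0 \<le> r" "r \<le> s"
      then show "norm (h r) \<le> \<eta> + norm y" using h_le[of r] \<beta>_le[of r] t by simp
    qed (use s v' in auto)
    also have "\<dots> = norm y + \<eta> * (1 - exp (- s))"
      using u\<^sub>\<delta>_init \<delta> by (simp add: v_def algebra_simps)
    also have "\<dots> \<le> norm y + \<eta>" using \<eta> mult_left_mono[of "1 - exp (- s)" 1 \<eta>] by simp
    finally have vs: "norm (v s) \<le> norm y + \<eta>" .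
    have "norm (v t) \<le> exp (s - t) * norm (v s) + (\<eta> + \<epsilon> / 4) * (1 - exp (s - t))"
    proof (rule relaxation_step_bound)
      fix r assume "s \<le> r" "r \<le> t"
      then show "norm (h r) \<le> \<eta> + \<epsilon> / 4" using h_le[of r] s by force
    qed (use s t v' in auto)
    also have "\<dots> \<le> exp (s - t) * (norm y + \<eta>) + (\<eta> + \<epsilon> / 4) * (1 - exp (s - t))"
      using vs by simp
    also have "\<dots> = exp (s - t) * norm y + \<eta> + \<epsilon> / 4 * (1 - exp (s - t))" by (simp add: algebra_simps)
    also have "\<dots> \<le> exp (s - t) * norm y + \<eta> + \<epsilon> / 4" using \<epsilon> by simp
    finally show ?thesis using \<eta> by (simp add: v_def \<eta>_def)
  qed
  have "filterlim (\<lambda>\<delta>. s - t\<^sub>\<delta> \<delta>) at_bot (at_right 0)"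
    using t\<^sub>\<delta>_lim filterlim_tendsto_add_at_top[OF tendsto_const[of "- s"] t\<^sub>\<delta>_lim]
    by (simp add: filterlim_uminus_at_bot)
  then have "((\<lambda>\<delta>. exp (s - t\<^sub>\<delta> \<delta>)) \<longlongrightarrow> 0) (at_right 0)"
    by (rule filterlim_compose[OF exp_at_bot])
  then have "((\<lambda>\<delta>. exp (s - t\<^sub>\<delta> \<delta>) * norm y + \<delta> / sqrt (a (t\<^sub>\<delta> \<delta>)) / 2 + \<epsilon> / 4)
      \<longlongrightarrow> 0 * norm y + 0 / 2 + \<epsilon> / 4) (at_right 0)"
    by (intro tendsto_intros t\<^sub>\<delta>_rate) simp_all
  from order_tendstoD(2)[OF this, of \<epsilon>]
  have "\<forall>\<^sub>F \<delta> in at_right 0. exp (s - t\<^sub>\<delta> \<delta>) * norm y + \<delta> / sqrt (a (t\<^sub>\<delta> \<delta>)) / 2 + \<epsilon> / 4 < \<epsilon>"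
    using \<epsilon> by simp
  moreover have "\<forall>\<^sub>F \<delta> in at_right 0. t\<^sub>\<delta> \<delta> \<ge> s" using t\<^sub>\<delta>_lim by (simp add: filterlim_at_top)
  moreover have "\<forall>\<^sub>F \<delta> :: real in at_right 0. \<delta> > 0" by (simp add: eventually_at_right_less)
  ultimately show "\<forall>\<^sub>F \<delta> in at_right 0. dist (norm (u\<^sub>\<delta> \<delta> (t\<^sub>\<delta> \<delta>) - y)) 0 < \<epsilon>"
  proof eventually_elim
    case (elim \<delta>)
    then show ?case using bound[of \<delta> "t\<^sub>\<delta> \<delta>"] by simp
  qed
qed

end
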